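(* Let $\mathcal A$ be an arrangement of $d$ lines with $m(\mathcal A)\le 6$ in which every line passes through at most two points of multiplicity at least three. Then $\tau(\mathcal A)\le121$ if $d=14$, $\tau(\mathcal A)\le141$ if $d=15$, and $\tau(\mathcal A)\le160$ if $d=16$. If moreover $d=14$ and $m(\mathcal A)\le4$, then $\tau(\mathcal A)\le112$, and if $d=16$ and $m(\mathcal A)\le5$, then $\tau(\mathcal A)\le156$. In particular, no such arrangement $\mathcal A$ has any of the following numerical types: (a) $d=14$ and $(n_2,n_3,n_4)\in\{(1,22,4),(1,20,5),(4,17,6),(7,14,7)\}$ with $m(\mathcal A)=4$, or $(n_2,n_3,n_4,n_5)\in\{(0,25,1,1),(0,23,2,1),(3,20,3,1),(6,17,4,1),(2,23,0,2),(5,20,1,2)\}$ with $m(\mathcal A)=5$; (b) $(d,m(\mathcal A))=(14,5)$ with $\tau(\mathcal A)\in\{125,126,127\}$; $(d,m(\mathcal A))=(15,5)$ with $\tau(\mathcal A)\in\{147,148\}$; $(d,m(\mathcal A))=(15,6)$ with $143\le\tau(\mathcal A)\le147$; $(d,m(\mathcal A))=(16,5)$ with $\tau(\mathcal A)=171$; $(d,m(\mathcal A))=(16,6)$ with $166\le\tau(\mathcal A)\le169$; (c) $d=15$, $m(\mathcal A)\in\{4,5\}$ with $141<\tau(\mathcal A)\le147$; $d=16$, $m(\mathcal A)=4$ with $164\le\tau(\mathcal A)\le169$; $d=16$, $m(\mathcal A)=5$ with $156<\tau(\mathcal A)\le169$.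
   Context: All arrangements are essential (the lines do not all pass through one point) arrangements of pairwise distinct lines in $\mathbb P^2_{\mathbb C}$. The multiplicity of a point is the number of lines of $\mathcal A$ through it; $m(\mathcal A)$ is the maximal multiplicity, $n_k=n_k(\mathcal A)$ is the number of points lying on exactly $k$ lines of $\mathcal A$ ($k\ge2$), and $\tau(\mathcal A)=\sum_{k\ge2}(k-1)^2n_k$. *)

theory Defs
  imports "HOL-Analysis.Analysis"
begin

text \<open>
  Points and lines of the complex projective plane are the one- and two-dimensional complex linear
  subspaces of \<open>complex ^ 3\<close> (\<open>vec.subspace\<close> and \<open>vec.dim\<close> refer to the scalar multiplication
  \<open>*s\<close> by complex numbers); a point lies on a line iff it is contained in it.
\<close>

type_synonym cvec3 = "complex ^ 3"

definition proj_point :: "cvec3 set \<Rightarrow> bool" where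
  "proj_point p \<longleftrightarrow> vec.subspace p \<and> vec.dim p = 1"

definition proj_line :: "cvec3 set \<Rightarrow> bool" where
  "proj_line L \<longleftrightarrow> vec.subspace L \<and> vec.dim L = 2"

definition line_arrangement :: "cvec3 set set \<Rightarrow> bool" where
  "line_arrangement A \<longleftrightarrow> finite A \<and> (\<forall>L\<in>A. proj_line L)"

definition essential :: "cvec3 set set \<Rightarrow> bool" where
  "essential A \<longleftrightarrow> \<not> (\<exists>p. proj_point p \<and> (\<forall>L\<in>A. p \<subseteq> L))"

definition point_mult :: "cvec3 set set \<Rightarrow> cvec3 set \<Rightarrow> nat" where
  "point_mult A p = card {L \<in> A. p \<subseteq> L}"

definition max_mult :: "cvec3 set set \<Rightarrow> nat" where
  "max_mult A = Max {point_mult A p | p. proj_point p}"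

text \<open>
  Meaningful for \<open>k \<ge> 2\<close> only: for \<open>k \<le> 1\<close> there are infinitely many such points in general.
\<close>

definition n_points :: "cvec3 set set \<Rightarrow> nat \<Rightarrow> nat" where
  "n_points A k = card {p. proj_point p \<and> point_mult A p = k}"

text \<open>
  No point has multiplicity greater than \<open>card A\<close>, so this is the sum over all \<open>k \<ge> 2\<close>.
\<close>

definition tau :: "cvec3 set set \<Rightarrow> nat" where
  "tau A = (\<Sum>k = 2..card A. (k - 1)\<^sup>2 * n_points A k)"

end

theory Submission
  imports Defs
begin

text \<open>
  Since \<open>(k - 1)\<^sup>2 = (k choose 2) + (k - 1 choose 2)\<close> and two lines meet in at most one point,
  \<open>\<tau>\<close> is at most \<open>(d choose 2) + n\<^sub>3 + 3 n\<^sub>4 + 6 n\<^sub>5 + 10 n\<^sub>6\<close>.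
  The last four terms are bounded by counting incidences: in a set \<open>S\<close> of points of multiplicity
  at least three, a point of multiplicity \<open>w\<close> lies on at least \<open>w + 1 - |S|\<close> lines without
  any other point of \<open>S\<close>. Adding these missing incidences to the actual ones, no line is
  counted more than twice, so \<open>\<Sum>\<^sub>S w + \<Sum>\<^sub>S (w + 1 - |S|) \<le> 2 d\<close>. A few choices of \<open>S\<close> exclude
  every numerical type that would violate the bound.
\<close>

section \<open>Double counting in an abstract incidence relation\<close>

lemma incidence_count:
  assumes "finite A" "finite S"
    and two: "\<And>L. L \<in> A \<Longrightarrow> card {p \<in> S. I p L} \<le> 2"
    and unique: "\<And>p q L M. \<lbrakk>p \<in> S; q \<in> S; p \<noteq> q; L \<in> A; M \<in> A; I p L; I q L; I p M; I q M\<rbrakk> \<Longrightarrow> L = M"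
  shows "(\<Sum>p\<in>S. card {L \<in> A. I p L}) + (\<Sum>p\<in>S. card {L \<in> A. I p L} + 1 - card S) \<le> 2 * card A"
proof -
  define c where "c L = card {p \<in> S. I p L}" for L
  have double: "(\<Sum>p\<in>S. card {L \<in> B. I p L}) = (\<Sum>L\<in>B. c L)" if "B \<subseteq> A" for B
  proof -
    have "finite B" using that assms(1) finite_subset by blast
    with \<open>finite S\<close> show ?thesis
      unfolding c_def card_eq_sum by (rule sum.swap_restrict)
  qed
  \<comment> \<open>Choosing a second point of \<open>S\<close> on each line of \<open>?V\<close>
    injects \<open>?V\<close> into \<open>S - {p}\<close>, so all but at most
    \<open>card S - 1\<close> lines through \<open>p\<close> meet \<open>S\<close> in
    \<open>p\<close> alone. The subtraction truncates: a set \<open>S\<close> with more points than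
    lines through \<open>p\<close> gives the trivial bound 0.\<close>
  have single: "card {L \<in> A. I p L} + 1 - card S \<le> card {L \<in> {L \<in> A. c L = 1}. I p L}" if p: "p \<in> S" for p
  proof -
    let ?U = "{L \<in> {L \<in> A. c L = 1}. I p L}" and ?V = "{L \<in> A. I p L \<and> c L \<noteq> 1}"
    have "\<exists>q. q \<in> S - {p} \<and> I q L" if "L \<in> ?V" for L
    proof (rule ccontr)
      assume "\<nexists>q. q \<in> S - {p} \<and> I q L"
      with p that have "{q \<in> S. I q L} = {p}" by blast
      then have "c L = 1" by (simp add: c_def)
      with that show False by simp
    qed
    then obtain f where f: "\<And>L. L \<in> ?V \<Longrightarrow> f L \<in> S - {p} \<and> I (f L) L" by metis
    have "inj_on f ?V"
    proof (rule inj_onI)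
      fix L M assume "L \<in> ?V" "M \<in> ?V" "f L = f M"
      then show "L = M" using f[of L] f[of M] unique[of p "f L" L M] p by auto
    qed
    moreover have "f ` ?V \<subseteq> S - {p}" using f by blast
    ultimately have "card ?V \<le> card (S - {p})"
      using \<open>finite S\<close> card_inj_on_le by blast
    also have "\<dots> = card S - 1" using p by simp
    finally have "card ?V \<le> card S - 1" .
    moreover have "card S \<ge> 1" using p \<open>finite S\<close> card_gt_0_iff[of S] by force
    moreover have "card {L \<in> A. I p L} = card ?U + card ?V"
    proof -
      have "{L \<in> A. I p L} = ?U \<union> ?V" by blast
      moreover have "card (?U \<union> ?V) = card ?U + card ?V"
        by (rule card_Un_disjoint) (use \<open>finite A\<close> in auto)
      ultimately show ?thesis by simp
    qed
    ultimately show ?thesis by linarith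
  qed
  have "(\<Sum>p\<in>S. card {L \<in> A. I p L} + 1 - card S) \<le> (\<Sum>p\<in>S. card {L \<in> {L \<in> A. c L = 1}. I p L})"
    by (intro sum_mono single)
  also have "\<dots> = (\<Sum>L\<in>{L \<in> A. c L = 1}. c L)" by (rule double) auto
  also have "\<dots> = (\<Sum>L\<in>A. if c L = 1 then 1 else 0)"
    using \<open>finite A\<close> by (simp add: sum.inter_filter[symmetric])
  finally have "(\<Sum>p\<in>S. card {L \<in> A. I p L}) + (\<Sum>p\<in>S. card {L \<in> A. I p L} + 1 - card S)
      \<le> (\<Sum>L\<in>A. c L + (if c L = 1 then 1 else 0))"
    using double[of A] by (simp add: sum.distrib)
  \<comment> \<open>A line contributes 0, 2 or 2 according as \<open>c L\<close> is 0, 1 or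
    2.\<close>
  also have "\<dots> \<le> (\<Sum>L\<in>A. 2)"
    using two by (intro sum_mono) (auto simp: c_def)
  finally show ?thesis by simp
qed

text \<open>A pair of lines has at most one common point in \<open>Q\<close>, so the pairs of lines
  through different points form disjoint families of two-element subsets of
  \<open>A\<close>.\<close>

lemma sum_choose_two_le:
  assumes "finite A" "finite Q"
    and unique: "\<And>p q L M. \<lbrakk>p \<in> Q; q \<in> Q; p \<noteq> q; L \<in> A; M \<in> A; I p L; I q L; I p M; I q M\<rbrakk> \<Longrightarrow> L = M"
  shows "(\<Sum>p\<in>Q. card {L \<in> A. I p L} choose 2) \<le> card A choose 2"
proof -
  let ?B = "\<lambda>p. {B. B \<subseteq> {L \<in> A. I p L} \<and> card B = 2}"
  have disj: "?B p \<inter> ?B q = {}" if "p \<in> Q" "q \<in> Q" "p \<noteq> q" for p q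
  proof (rule ccontr)
    assume "?B p \<inter> ?B q \<noteq> {}"
    then obtain B where B: "B \<in> ?B p" "B \<in> ?B q" by blast
    then obtain L M where "B = {L, M}" "L \<noteq> M" by (auto simp: card_2_iff)
    with B show False using unique[of p q L M] that by simp
  qed
  have fin: "finite (?B p)" for p
    by (rule finite_subset[of _ "Pow A"]) (use \<open>finite A\<close> in auto)
  have "(\<Sum>p\<in>Q. card {L \<in> A. I p L} choose 2) = (\<Sum>p\<in>Q. card (?B p))"
    using \<open>finite A\<close> by (simp add: n_subsets)
  also have "\<dots> = card (\<Union>p\<in>Q. ?B p)"
    by (rule card_UN_disjoint[symmetric]) (use \<open>finite Q\<close> fin disj in blast)+
  also have "\<dots> \<le> card {B. B \<subseteq> A \<and> card B = 2}"
    by (rule card_mono) (use \<open>finite A\<close> in auto)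
  also have "\<dots> = card A choose 2" using \<open>finite A\<close> by (simp add: n_subsets)
  finally show ?thesis .
qed

text \<open>Two consecutive triangular numbers add up to a square.\<close>

lemma pred_square_eq_choose: "k \<ge> 1 \<Longrightarrow> (k - 1)\<^sup>2 = (k choose 2) + (k - 1 choose 2)"
proof (induction k rule: dec_induct)
  case (step n)
  then obtain m where "n = Suc m" by (cases n) auto
  with step show ?case by (simp add: numeral_2_eq_2 algebra_simps)
qed (simp add: numeral_2_eq_2)

section \<open>Multiple points of an arrangement\<close>

lemma proj_point_eq_Int:
  assumes "proj_line L" "proj_line M" "L \<noteq> M" "proj_point p" "p \<subseteq> L" "p \<subseteq> M"
  shows "p = L \<inter> M"
proof -
  have sub: "vec.subspace (L \<inter> M)"
    using assms by (simp add: proj_line_def vec.subspace_inter)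
  \<comment> \<open>An intersection of dimension two would coincide with both lines. Once this is
    excluded, \<open>p\<close> already has the full dimension of the intersection containing
    it.\<close>
  have "vec.dim (L \<inter> M) \<le> 1"
  proof (rule ccontr)
    assume "\<not> vec.dim (L \<inter> M) \<le> 1"
    then have "L \<inter> M = L" "L \<inter> M = M"
      using assms(1,2) sub by (intro vec.subspace_dim_equal; simp add: proj_line_def)+
    with \<open>L \<noteq> M\<close> show False by blast
  qed
  then show ?thesis
    using assms sub by (intro vec.subspace_dim_equal) (auto simp: proj_point_def)
qed

lemma proj_line_unique:
  assumes "proj_line L" "proj_line M" "proj_point p" "proj_point q" "p \<noteq> q"
    "p \<subseteq> L" "q \<subseteq> L" "p \<subseteq> M" "q \<subseteq> M"
  shows "L = M"
  using assms proj_point_eq_Int by metis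

text \<open>Each such point is the intersection of two lines of \<open>A\<close>. Since
  \<open>card\<close> is 0 on infinite sets, this is what makes \<open>n_points A k\<close> a true
  count for k \<ge> 2.\<close>

lemma finite_multiple_points:
  assumes "line_arrangement A"
  shows "finite {p. proj_point p \<and> point_mult A p \<ge> 2}"
proof (rule finite_subset)
  show "finite ((\<lambda>(L, M). L \<inter> M) ` (A \<times> A))"
    using assms by (simp add: line_arrangement_def)
  show "{p. proj_point p \<and> point_mult A p \<ge> 2} \<subseteq> (\<lambda>(L, M). L \<inter> M) ` (A \<times> A)"
  proof
    fix p assume "p \<in> {p. proj_point p \<and> point_mult A p \<ge> 2}"
    then have p: "proj_point p" and "2 \<le> card {L \<in> A. p \<subseteq> L}" by (auto simp: point_mult_def)
    then obtain B where "B \<subseteq> {L \<in> A. p \<subseteq> L}" "card B = 2" by (meson obtain_subset_with_card_n)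
    moreover from this obtain L M where "B = {L, M}" "L \<noteq> M" by (auto simp: card_2_iff)
    ultimately have LM: "L \<in> A" "M \<in> A" "p \<subseteq> L" "p \<subseteq> M" "L \<noteq> M" by auto
    then have "p = L \<inter> M"
      using p assms by (intro proj_point_eq_Int) (auto simp: line_arrangement_def)
    with LM show "p \<in> (\<lambda>(L, M). L \<inter> M) ` (A \<times> A)" by auto
  qed
qed

lemma point_mult_le_card: "finite A \<Longrightarrow> point_mult A p \<le> card A"
  unfolding point_mult_def by (rule card_mono) auto

lemma point_mult_le_max_mult:
  assumes "finite A" "proj_point p"
  shows "point_mult A p \<le> max_mult A"
  unfolding max_mult_def
proof (rule Max_ge)
  have "{point_mult A p |p. proj_point p} \<subseteq> {..card A}"
    using point_mult_le_card[OF \<open>finite A\<close>] by auto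
  then show "finite {point_mult A p |p. proj_point p}"
    by (rule finite_subset) simp
qed (use assms in blast)

lemma n_points_eq_0:
  assumes "finite A" "max_mult A < k"
  shows "n_points A k = 0"
proof -
  have "{p. proj_point p \<and> point_mult A p = k} = {}"
    using point_mult_le_max_mult[OF \<open>finite A\<close>] assms(2) by fastforce
  then show ?thesis by (simp only: n_points_def card.empty)
qed

text \<open>The points are grouped by multiplicity. The upper limit \<open>n\<close> is left free,
  so that the identity serves both the range up to \<open>card A\<close> in \<open>tau\<close> and
  the range up to 6.\<close>

lemma sum_points_by_mult:
  assumes "line_arrangement A" "2 \<le> m" "\<And>p. proj_point p \<Longrightarrow> point_mult A p \<le> n"
  shows "(\<Sum>p | proj_point p \<and> m \<le> point_mult A p. h (point_mult A p)) = (\<Sum>k = m..n. h k * n_points A k)"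
proof -
  let ?Q = "{p. proj_point p \<and> m \<le> point_mult A p}"
  have "finite ?Q"
    by (rule finite_subset[OF _ finite_multiple_points[OF assms(1)]]) (use assms(2) in auto)
  then have "(\<Sum>p\<in>?Q. h (point_mult A p)) = (\<Sum>k = m..n. \<Sum>p | p \<in> ?Q \<and> point_mult A p = k. h (point_mult A p))"
    by (intro sum.group[symmetric]) (use assms(3) in auto)
  also have "\<dots> = (\<Sum>k = m..n. h k * n_points A k)"
  proof (rule sum.cong)
    fix k assume "k \<in> {m..n}"
    then have "{p. p \<in> ?Q \<and> point_mult A p = k} = {p. proj_point p \<and> point_mult A p = k}" by auto
    then show "(\<Sum>p | p \<in> ?Q \<and> point_mult A p = k. h (point_mult A p)) = h k * n_points A k"
      by (simp add: n_points_def)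
  qed simp
  finally show ?thesis .
qed

section \<open>Upper bound for \<tau> and inequalities from incidences\<close>

lemma tau_le:
  assumes A: "line_arrangement A" and max: "max_mult A \<le> 6"
  shows "tau A \<le> (card A choose 2)
    + (n_points A 3 + 3 * n_points A 4 + 6 * n_points A 5 + 10 * n_points A 6)"
proof -
  have finA: "finite A" using A by (simp add: line_arrangement_def)
  let ?Q = "{p. proj_point p \<and> 2 \<le> point_mult A p}"
  have "tau A = (\<Sum>p\<in>?Q. (point_mult A p - 1)\<^sup>2)"
    unfolding tau_def using sum_points_by_mult[OF A, of 2 "card A" "\<lambda>k. (k - 1)\<^sup>2"]
      point_mult_le_card[OF finA] by simp
  also have "\<dots> = (\<Sum>p\<in>?Q. (point_mult A p choose 2) + (point_mult A p - 1 choose 2))"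
    by (intro sum.cong pred_square_eq_choose) auto
  also have "\<dots> = (\<Sum>p\<in>?Q. point_mult A p choose 2) + (\<Sum>k = 2..6. (k - 1 choose 2) * n_points A k)"
  proof -
    have "point_mult A p \<le> 6" if "proj_point p" for p
      using point_mult_le_max_mult[OF finA that] max by simp
    with sum_points_by_mult[OF A, of 2 6 "\<lambda>k. k - 1 choose 2"]
    show ?thesis by (simp add: sum.distrib)
  qed
  \<comment> \<open>The factors \<open>k - 1 choose 2\<close> are 0, 1, 3, 6, 10, so double points
    drop out.\<close>
  also have "(\<Sum>k = 2..6. (k - 1 choose 2) * n_points A k)
      = n_points A 3 + 3 * n_points A 4 + 6 * n_points A 5 + 10 * n_points A 6"
  proof -
    have "{2..6} = {2, 3, 4, 5, 6 :: nat}" by auto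
    then show ?thesis by (simp add: choose_two)
  qed
  finally have "tau A = (\<Sum>p\<in>?Q. point_mult A p choose 2)
      + (n_points A 3 + 3 * n_points A 4 + 6 * n_points A 5 + 10 * n_points A 6)" .
  moreover have "(\<Sum>p\<in>?Q. point_mult A p choose 2) \<le> card A choose 2"
    unfolding point_mult_def
  proof (rule sum_choose_two_le[OF finA])
    show "finite {p. proj_point p \<and> 2 \<le> card {L \<in> A. p \<subseteq> L}}"
      using finite_multiple_points[OF A] by (simp add: point_mult_def)
  next
    fix p q L M
    assume "p \<in> {p. proj_point p \<and> 2 \<le> card {L \<in> A. p \<subseteq> L}}"
      "q \<in> {p. proj_point p \<and> 2 \<le> card {L \<in> A. p \<subseteq> L}}"
      "p \<noteq> q" "L \<in> A" "M \<in> A" "p \<subseteq> L" "q \<subseteq> L" "p \<subseteq> M" "q \<subseteq> M"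
    with A show "L = M"
      using proj_line_unique[of L M p q] by (auto simp: line_arrangement_def)
  qed
  ultimately show ?thesis by linarith
qed

lemma triple_points_incidence_count:
  assumes A: "line_arrangement A"
    and two: "\<forall>L\<in>A. card {p. proj_point p \<and> p \<subseteq> L \<and> point_mult A p \<ge> 3} \<le> 2"
    and S: "S \<subseteq> {p. proj_point p \<and> point_mult A p \<ge> 3}"
  shows "(\<Sum>p\<in>S. point_mult A p) + (\<Sum>p\<in>S. point_mult A p + 1 - card S) \<le> 2 * card A"
  unfolding point_mult_def
proof (rule incidence_count)
  show "finite A" using A by (simp add: line_arrangement_def)
  have fin: "finite {p. proj_point p \<and> point_mult A p \<ge> 3}"
    by (rule finite_subset[OF _ finite_multiple_points[OF A]]) auto
  with S show "finite S" by (rule finite_subset)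
  show "card {p \<in> S. p \<subseteq> L} \<le> 2" if "L \<in> A" for L
  proof -
    have "finite {p. proj_point p \<and> p \<subseteq> L \<and> point_mult A p \<ge> 3}"
      by (rule finite_subset[OF _ fin]) auto
    then have "card {p \<in> S. p \<subseteq> L} \<le> card {p. proj_point p \<and> p \<subseteq> L \<and> point_mult A p \<ge> 3}"
      by (rule card_mono) (use S in auto)
    also have "\<dots> \<le> 2" using two that by blast
    finally show ?thesis .
  qed
  show "L = M" if "p \<in> S" "q \<in> S" "p \<noteq> q" "L \<in> A" "M \<in> A"
    "p \<subseteq> L" "q \<subseteq> L" "p \<subseteq> M" "q \<subseteq> M" for p q L M
    by (rule proj_line_unique[of L M p q]) (use that A S in \<open>auto simp: line_arrangement_def\<close>)
qed

lemma sum_incidences_le: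
  assumes A: "line_arrangement A" and max: "max_mult A \<le> 6"
    and two: "\<forall>L\<in>A. card {p. proj_point p \<and> p \<subseteq> L \<and> point_mult A p \<ge> 3} \<le> 2"
  shows "3 * n_points A 3 + 4 * n_points A 4 + 5 * n_points A 5 + 6 * n_points A 6 \<le> 2 * card A"
proof -
  have finA: "finite A" using A by (simp add: line_arrangement_def)
  have "{3..6} = {3, 4, 5, 6 :: nat}" by auto
  moreover have "point_mult A p \<le> 6" if "proj_point p" for p
    using point_mult_le_max_mult[OF finA that] max by simp
  ultimately have "3 * n_points A 3 + 4 * n_points A 4 + 5 * n_points A 5 + 6 * n_points A 6
      = (\<Sum>p | proj_point p \<and> 3 \<le> point_mult A p. point_mult A p)"
    using sum_points_by_mult[OF A, of 3 6 "\<lambda>k. k"] by simp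
  \<comment> \<open>Here \<open>S\<close> consists of all points of multiplicity at least three, and
    the second sum is estimated below by 0.\<close>
  with triple_points_incidence_count[OF A two order.refl] show ?thesis by linarith
qed

text \<open>A test for forbidden configurations: \<open>S\<close> is made of \<open>a\<close>,
  \<open>b\<close>, \<open>c\<close> points of multiplicity 6, 5, 4. If the left side, a number
  depending on \<open>a\<close>, \<open>b\<close>, \<open>c\<close> only, exceeds
  \<open>2 * card A\<close>, then not all three counts can be that large.\<close>

lemma sub_configuration_count:
  assumes A: "line_arrangement A"
    and two: "\<forall>L\<in>A. card {p. proj_point p \<and> p \<subseteq> L \<and> point_mult A p \<ge> 3} \<le> 2"
    and le: "a \<le> n_points A 6" "b \<le> n_points A 5" "c \<le> n_points A 4"
    and N: "N = a + b + c"
  shows "a * 6 + b * 5 + c * 4 + (a * (7 - N) + b * (6 - N) + c * (5 - N)) \<le> 2 * card A"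
proof -
  obtain S6 where S6: "S6 \<subseteq> {p. proj_point p \<and> point_mult A p = 6}" "card S6 = a" "finite S6"
    by (rule obtain_subset_with_card_n[OF le(1)[unfolded n_points_def]])
  obtain S5 where S5: "S5 \<subseteq> {p. proj_point p \<and> point_mult A p = 5}" "card S5 = b" "finite S5"
    by (rule obtain_subset_with_card_n[OF le(2)[unfolded n_points_def]])
  obtain S4 where S4: "S4 \<subseteq> {p. proj_point p \<and> point_mult A p = 4}" "card S4 = c" "finite S4"
    by (rule obtain_subset_with_card_n[OF le(3)[unfolded n_points_def]])
  let ?S = "S6 \<union> S5 \<union> S4"
  have disj: "S6 \<inter> S5 = {}" "(S6 \<union> S5) \<inter> S4 = {}" using S6(1) S5(1) S4(1) by fastforce+
  have sum_S: "(\<Sum>p\<in>?S. h (point_mult A p)) = a * h 6 + b * h 5 + c * h 4" for h :: "nat \<Rightarrow> nat"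
  proof -
    have "(\<Sum>p\<in>T. h (point_mult A p)) = card T * h k"
      if "T \<subseteq> {p. proj_point p \<and> point_mult A p = k}" for T k
    proof -
      have "(\<Sum>p\<in>T. h (point_mult A p)) = (\<Sum>p\<in>T. h k)"
        by (rule sum.cong) (use that in auto)
      then show ?thesis by simp
    qed
    with S6 S5 S4 disj show ?thesis by (simp add: sum.union_disjoint)
  qed
  have "card ?S = N" using S6 S5 S4 disj N by (simp add: card_Un_disjoint)
  moreover have "(\<Sum>p\<in>?S. point_mult A p) + (\<Sum>p\<in>?S. point_mult A p + 1 - card ?S) \<le> 2 * card A"
    by (rule triple_points_incidence_count[OF A two]) (use S6 S5 S4 in auto)
  ultimately show ?thesis
    using sum_S[of "\<lambda>k. k"] sum_S[of "\<lambda>k. k + 1 - N"] by simp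
qed

text \<open>Turns a prescribed numerical type into a lower bound for \<tau>; with at least five
  lines the multiplicities 2 to 5 lie in the range of summation.\<close>

lemma tau_ge_partial_sum:
  assumes "5 \<le> card A"
  shows "n_points A 2 + 4 * n_points A 3 + 9 * n_points A 4 + 16 * n_points A 5 \<le> tau A"
proof -
  have "(\<Sum>k\<in>{2, 3, 4, 5}. (k - 1)\<^sup>2 * n_points A k) \<le> tau A"
    unfolding tau_def by (rule sum_mono2) (use assms in auto)
  then show ?thesis by simp
qed

section \<open>Integer optimization of the excess over the number of pairs of lines\<close>

lemma weight_bound_14:
  fixes n3 n4 n5 n6 :: nat
  assumes "3 * n3 + 4 * n4 + 5 * n5 + 6 * n6 \<le> 28"
    and "\<not> (3 \<le> n6)"
    and "\<not> (2 \<le> n6 \<and> 2 \<le> n5)"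
    and "\<not> (1 \<le> n6 \<and> 3 \<le> n5)"
    and "\<not> (2 \<le> n6 \<and> 1 \<le> n5 \<and> 1 \<le> n4)"
    and "\<not> (5 \<le> n5)"
    and "\<not> (1 \<le> n6 \<and> 2 \<le> n5 \<and> 3 \<le> n4)"
    and "\<not> (2 \<le> n6 \<and> 4 \<le> n4)"
  shows "n3 + 3 * n4 + 6 * n5 + 10 * n6 \<le> 30"
proof -
  \<comment> \<open>For fixed \<open>n6\<close> and \<open>n5\<close> only a linear problem in
    \<open>n3\<close> and \<open>n4\<close> remains. The value 30 is attained, for example by
    \<open>n5 = 4\<close>, \<open>n4 = 2\<close>.\<close>
  have "n6 = 0 \<or> n6 = 1 \<or> n6 = 2" "n5 = 0 \<or> n5 = 1 \<or> n5 = 2 \<or> n5 = 3 \<or> n5 = 4"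
    using assms(2,6) by linarith+
  with assms show ?thesis by (elim disjE) simp_all
qed

lemma weight_bound_15:
  fixes n3 n4 n5 n6 :: nat
  assumes "3 * n3 + 4 * n4 + 5 * n5 + 6 * n6 \<le> 30"
    and "\<not> (3 \<le> n6 \<and> 1 \<le> n5)"
    and "\<not> (4 \<le> n6)"
    and "\<not> (2 \<le> n6 \<and> 2 \<le> n5)"
    and "\<not> (3 \<le> n6 \<and> 1 \<le> n4)"
    and "\<not> (1 \<le> n6 \<and> 4 \<le> n5)"
  shows "n3 + 3 * n4 + 6 * n5 + 10 * n6 \<le> 36"
proof -
  \<comment> \<open>For \<open>n6 = 0\<close> the ratio 6/5 of weight to incidences at a point of
    multiplicity five gives exactly 36; each other value of \<open>n6\<close> brings its own bound
    on \<open>n5\<close>.\<close>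
  have "n6 = 0 \<or> n6 = 1 \<or> n6 = 2 \<or> n6 = 3" using assms(3) by linarith
  with assms show ?thesis by (elim disjE) simp_all
qed

lemma weight_bound_16:
  fixes n3 n4 n5 n6 :: nat
  assumes "3 * n3 + 4 * n4 + 5 * n5 + 6 * n6 \<le> 32"
    and "\<not> (4 \<le> n6)"
    and "\<not> (3 \<le> n6 \<and> 1 \<le> n5)"
    and "\<not> (2 \<le> n6 \<and> 3 \<le> n5)"
  shows "n3 + 3 * n4 + 6 * n5 + 10 * n6 \<le> 40"
proof -
  \<comment> \<open>For \<open>n6 = 1\<close> the linear relaxation gives only 10 + 26 * 6/5 = 41.2,
    hence the split over \<open>n5\<close> as well.\<close>
  have "n6 = 0 \<or> n6 = 1 \<or> n6 = 2 \<or> n6 = 3"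
    "n5 = 0 \<or> n5 = 1 \<or> n5 = 2 \<or> n5 = 3 \<or> n5 = 4 \<or> n5 = 5 \<or> n5 = 6"
    using assms(1,2) by linarith+
  with assms show ?thesis by (elim disjE) simp_all
qed

lemma weight_bound_16_max_5:
  fixes n3 n4 n5 :: nat
  assumes "3 * n3 + 4 * n4 + 5 * n5 \<le> 32"
  shows "n3 + 3 * n4 + 6 * n5 \<le> 36"
proof -
  \<comment> \<open>The linear relaxation gives 32 * 6/5 = 38.4; integrality of \<open>n5\<close>
    lowers this to 36.\<close>
  have "n5 = 0 \<or> n5 = 1 \<or> n5 = 2 \<or> n5 = 3 \<or> n5 = 4 \<or> n5 = 5 \<or> n5 = 6"
    using assms by linarith
  with assms show ?thesis by (elim disjE) simp_all
qed

section \<open>Bounds for 14, 15 and 16 lines and the excluded types\<close>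

theorem theorem1p7:
  fixes A :: "cvec3 set set" and d :: nat
  assumes "line_arrangement A" and "essential A" and "card A = d"
    and "max_mult A \<le> 6"
    and "\<forall>L\<in>A. card {p. proj_point p \<and> p \<subseteq> L \<and> point_mult A p \<ge> 3} \<le> 2"
  shows "(d = 14 \<longrightarrow> tau A \<le> 121)
    \<and> (d = 15 \<longrightarrow> tau A \<le> 141)
    \<and> (d = 16 \<longrightarrow> tau A \<le> 160)
    \<and> (d = 14 \<and> max_mult A \<le> 4 \<longrightarrow> tau A \<le> 112)
    \<and> (d = 16 \<and> max_mult A \<le> 5 \<longrightarrow> tau A \<le> 156)
    \<and> \<not> (d = 14 \<and> max_mult A = 4 \<and>
          (n_points A 2, n_points A 3, n_points A 4)
            \<in> {(1,22,4), (1,20,5), (4,17,6), (7,14,7)})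
    \<and> \<not> (d = 14 \<and> max_mult A = 5 \<and>
          (n_points A 2, n_points A 3, n_points A 4, n_points A 5)
            \<in> {(0,25,1,1), (0,23,2,1), (3,20,3,1), (6,17,4,1), (2,23,0,2), (5,20,1,2)})
    \<and> \<not> (d = 14 \<and> max_mult A = 5 \<and> tau A \<in> {125, 126, 127})
    \<and> \<not> (d = 15 \<and> max_mult A = 5 \<and> tau A \<in> {147, 148})
    \<and> \<not> (d = 15 \<and> max_mult A = 6 \<and> 143 \<le> tau A \<and> tau A \<le> 147)
    \<and> \<not> (d = 16 \<and> max_mult A = 5 \<and> tau A = 171)
    \<and> \<not> (d = 16 \<and> max_mult A = 6 \<and> 166 \<le> tau A \<and> tau A \<le> 169)
    \<and> \<not> (d = 15 \<and> max_mult A \<in> {4, 5} \<and> 141 < tau A \<and> tau A \<le> 147)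
    \<and> \<not> (d = 16 \<and> max_mult A = 4 \<and> 164 \<le> tau A \<and> tau A \<le> 169)
    \<and> \<not> (d = 16 \<and> max_mult A = 5 \<and> 156 < tau A \<and> tau A \<le> 169)"
proof -
  let ?n = "n_points A"
  have finA: "finite A" using assms(1) by (simp add: line_arrangement_def)
  have tau: "tau A \<le> (d choose 2) + (?n 3 + 3 * ?n 4 + 6 * ?n 5 + 10 * ?n 6)"
    using tau_le[OF assms(1,4)] assms(3) by simp
  have inc: "3 * ?n 3 + 4 * ?n 4 + 5 * ?n 5 + 6 * ?n 6 \<le> 2 * d"
    using sum_incidences_le[OF assms(1,4,5)] assms(3) by simp
  have sub: "a * 6 + b * 5 + c * 4 + (a * (7 - (a + b + c)) + b * (6 - (a + b + c)) + c * (5 - (a + b + c))) \<le> 2 * d"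
    if "a \<le> ?n 6 \<and> b \<le> ?n 5 \<and> c \<le> ?n 4" for a b c
    using sub_configuration_count[OF assms(1,5)] that assms(3) by blast
  have bound14: "tau A \<le> 121" if "d = 14"
  proof -
    \<comment> \<open>30 is 121 minus the 91 pairs of lines. The instances of \<open>sub\<close>
      below have left sides 30, 32, 30, 30, 30, 29, 30, all above 28.\<close>
    have "?n 3 + 3 * ?n 4 + 6 * ?n 5 + 10 * ?n 6 \<le> 30"
      by (rule weight_bound_14)
        (use inc that sub[of 3 0 0] sub[of 2 2 0] sub[of 1 3 0] sub[of 2 1 1] sub[of 0 5 0] sub[of 1 2 3] sub[of 2 0 4] in auto)
    with tau that show ?thesis by (simp add: choose_two)
  qed
  have bound15: "tau A \<le> 141" if "d = 15"
  proof -
    \<comment> \<open>36 is 141 - 105; the left sides of \<open>sub\<close> are 34, 36, 32, 32, 32,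
      all above 30.\<close>
    have "?n 3 + 3 * ?n 4 + 6 * ?n 5 + 10 * ?n 6 \<le> 36"
      by (rule weight_bound_15)
        (use inc that sub[of 3 1 0] sub[of 4 0 0] sub[of 2 2 0] sub[of 3 0 1] sub[of 1 4 0] in auto)
    with tau that show ?thesis by (simp add: choose_two)
  qed
  have bound16: "tau A \<le> 160" if "d = 16"
  proof -
    \<comment> \<open>40 is 160 - 120; the left sides of \<open>sub\<close> are 36, 34, 34, all
      above 32.\<close>
    have "?n 3 + 3 * ?n 4 + 6 * ?n 5 + 10 * ?n 6 \<le> 40"
      by (rule weight_bound_16)
        (use inc that sub[of 4 0 0] sub[of 3 1 0] sub[of 2 3 0] in auto)
    with tau that show ?thesis by (simp add: choose_two)
  qed
  have bound14_4: "tau A \<le> 112" if "d = 14" "max_mult A \<le> 4"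
  proof -
    have "?n 5 = 0" "?n 6 = 0" using n_points_eq_0[OF finA] that(2) by auto
    \<comment> \<open>Three quarters of \<open>inc\<close> bounds \<open>?n 3 + 3 * ?n 4\<close> by
      21 = 112 - 91.\<close>
    with tau inc that(1) show ?thesis by (simp add: choose_two)
  qed
  have bound16_5: "tau A \<le> 156" if "d = 16" "max_mult A \<le> 5"
  proof -
    have "?n 6 = 0" using n_points_eq_0[OF finA] that(2) by auto
    with inc that(1) have "?n 3 + 3 * ?n 4 + 6 * ?n 5 \<le> 36"
      by (intro weight_bound_16_max_5) simp
    with tau that(1) \<open>?n 6 = 0\<close> show ?thesis by (simp add: choose_two)
  qed
  have partial: "?n 2 + 4 * ?n 3 + 9 * ?n 4 + 16 * ?n 5 \<le> tau A" if "d = 14"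
    using tau_ge_partial_sum[of A] that assms(3) by simp
  show ?thesis
    \<comment> \<open>By \<open>partial\<close>, every listed type with 14 lines forces \<tau> \<ge>
      125, above 121. Each excluded range of \<tau> lies entirely above the bound for its
      \<open>d\<close> and maximal multiplicity.\<close>
    using bound14 bound15 bound16 bound14_4 bound16_5 partial by (intro conjI) auto
qed

end
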